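(* Let $n\ge 1$ and, for each $t\in\{1,\dots,n\}$, let $\mathcal{M}_t$ be an $(\epsilon_t,\delta_t,\theta_t)$-trajectory private mechanism. Let $\mathcal{M}_{[n]}=\{\mathcal{M}_1,\mathcal{M}_2,\dots,\mathcal{M}_n\}$ be the mechanism that uses $\mathcal{M}_t$ to release a perturbed location $z_t$ at timestep $t$, for each $t\in\{1,\dots,n\}$. Then $\mathcal{M}_{[n]}$ is $(\epsilon_{[n]},\delta_{[n]},\theta_{[n]})$-trajectory private, where \[ \epsilon_{[n]}=\sum_{i=1}^n\epsilon_i,\qquad \delta_{[n]}=\prod_{i=1}^n\delta_i,\qquad \theta_{[n]}=\theta_n+\sum_{i=1}^{n-1}\theta_i\prod_{j=i+1}^{n}\delta_j^{-1}\cdot e^{\epsilon_j}. \] That is, for every trajectory $T\in\mathcal{T}$ and all outputs $z_1,\dots,z_n$, \[ Pr_n^+[T=T^*\mid l_n^*\in\mathcal{L}_n^*]\le \delta_{[n]}^{-1}\cdot e^{\epsilon_{[n]}}\cdot Pr_1^-[T=T^*]+\theta_{[n]}. \]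
   Context: Setting. $\mathcal{T}$ is the set of possible trajectories of a user and $T^*$ is the true trajectory. At each timestep $t$ the user's true location is $l^*_t$, the set of possible locations is $\mathcal{L}_t$, and a subset $\mathcal{L}^*_t\subseteq\mathcal{L}_t$ (the $\delta_t$-obfuscation set) with total prior probability $\delta_t\in(0,1]$ is used by the mechanism; the adversary knows that $l^*_t\in\mathcal{L}^*_t$. $Pr_t^-[T=T^*]$ is the adversary's belief that $T$ is the true trajectory just before the release at timestep $t$, and $Pr_t^+[T=T^*\mid l^*_t\in\mathcal{L}^*_t]$ is its belief after the release of $z_t$. Since no information about the user's location is disclosed between two consecutive releases, $Pr_{t+1}^-[T=T^*]=Pr_t^+[T=T^*\mid l^*_t\in\mathcal{L}^*_t]$ for all $T\in\mathcal{T}$ and all $t$. A mechanism used at timestep $t$ is $(\epsilon,\delta,\theta)$-trajectory private if for every $T\in\mathcal{T}$, any output $z_t$ and any adversary knowing that $l^*_t\in\mathcal{L}^*_t$, \[ Pr_t^+[T=T^*\mid l^*_t\in\mathcal{L}^*_t]\le\delta^{-1}\cdot e^{\epsilon}\cdot Pr_t^-[T=T^*]+\theta . \] For the composed mechanism $\mathcal{M}_{[n]}$, the prior is the belief before the first release, $Pr_1^-$, and the posterior is the belief after the last release, $Pr_n^+$. *)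

theory Defs
  imports "HOL-Probability.Probability"
begin

text \<open>
  A trajectory assigns a location to every timestep. A belief of the adversary is a distribution
  of the true trajectory \<open>T*\<close>; thus \<open>Pr[T = T*]\<close> is \<open>pmf p T\<close>, and \<open>l*\<^sub>t\<close> is the value of the
  true trajectory at \<open>t\<close>.
\<close>

type_synonym 'l trajectory = "nat \<Rightarrow> 'l"
type_synonym 'l belief = "'l trajectory pmf"

text \<open>
  What trajectory privacy refers to, for a single release (output type: a perturbed location) and
  for a sequence of releases (output type: a sequence of perturbed locations) alike:
  \<open>admits M p z\<close> says that an adversary with prior belief \<open>p\<close> has the knowledge presupposed by \<open>M\<close>
  and can observe the output \<open>z\<close>, and \<open>update M p z\<close> is the belief of this adversary afterwards.
\<close>

record ('l, 'o) mechanism =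
  admits :: "'l belief \<Rightarrow> 'o \<Rightarrow> bool"
  update :: "'l belief \<Rightarrow> 'o \<Rightarrow> 'l belief"

definition trajectory_private ::
    "'l trajectory set \<Rightarrow> ('l, 'o) mechanism \<Rightarrow> real \<Rightarrow> real \<Rightarrow> real \<Rightarrow> bool" where
  "trajectory_private \<T> M \<epsilon> \<delta> \<theta> \<longleftrightarrow>
     (\<forall>p z. set_pmf p \<subseteq> \<T> \<longrightarrow> admits M p z \<longrightarrow>
        (\<forall>T\<in>\<T>. pmf (update M p z) T \<le> inverse \<delta> * exp \<epsilon> * pmf p T + \<theta>))"

text \<open>
  A location perturbation mechanism. As the obfuscation set is a set of prescribed total prior
  probability, it depends on the prior belief, and the perturbation may depend on it as well (a
  mechanism with a fixed obfuscation set is a constant function). \<open>out_density K p l\<close> is the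
  density of the perturbed location, given the true location \<open>l\<close>, with respect to a reference
  measure on outputs (a counting measure for discrete outputs).
\<close>

record ('l, 'z) perturbation =
  obf_set :: "'l belief \<Rightarrow> 'l set"
  out_density :: "'l belief \<Rightarrow> 'l \<Rightarrow> 'z \<Rightarrow> real"

definition is_perturbation :: "'z measure \<Rightarrow> 'l set \<Rightarrow> ('l, 'z) perturbation \<Rightarrow> bool" where
  "is_perturbation \<nu> L K \<longleftrightarrow>
     (\<forall>p. obf_set K p \<subseteq> L \<and>
        (\<forall>l\<in>L. out_density K p l \<in> borel_measurable \<nu> \<and>
               (\<forall>z\<in>space \<nu>. 0 \<le> out_density K p l z) \<and>
               (\<integral>\<^sup>+z. ennreal (out_density K p l z) \<partial>\<nu>) = 1))"

text \<open>
  Bayes' rule for conditioning on the output \<open>z\<close> and on \<open>l*\<^sub>t\<close> being in the obfuscation set: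
  \<open>likelihood\<close> is the joint likelihood of both given that the true trajectory is \<open>T\<close>. The Bochner
  integral \<open>evidence\<close> is \<open>0\<close> if the likelihood is not integrable, so \<open>evidence > 0\<close> says exactly
  that the conditional distribution is well defined.
\<close>

definition likelihood ::
    "nat \<Rightarrow> ('l, 'z) perturbation \<Rightarrow> 'l belief \<Rightarrow> 'z \<Rightarrow> 'l trajectory \<Rightarrow> real" where
  "likelihood t K p z T = (if T t \<in> obf_set K p then out_density K p (T t) z else 0)"

definition evidence :: "nat \<Rightarrow> ('l, 'z) perturbation \<Rightarrow> 'l belief \<Rightarrow> 'z \<Rightarrow> real" where
  "evidence t K p z = measure_pmf.expectation p (likelihood t K p z)"

definition posterior :: "nat \<Rightarrow> ('l, 'z) perturbation \<Rightarrow> 'l belief \<Rightarrow> 'z \<Rightarrow> 'l belief" where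
  "posterior t K p z = embed_pmf (\<lambda>T. pmf p T * likelihood t K p z T / evidence t K p z)"

lemma pmf_posterior:
  assumes K: "is_perturbation \<nu> L K" and supp: "\<And>T. T \<in> set_pmf p \<Longrightarrow> T t \<in> L"
    and z: "z \<in> space \<nu>" and pos: "evidence t K p z > 0"
  shows "pmf (posterior t K p z) T = pmf p T * likelihood t K p z T / evidence t K p z"
proof -
  have nn: "0 \<le> likelihood t K p z S" if "S \<in> set_pmf p" for S
    using K supp[OF that] z by (auto simp: likelihood_def is_perturbation_def)
  have nn': "0 \<le> pmf p S * likelihood t K p z S / evidence t K p z" for S
    using nn[of S] pos by (cases "S \<in> set_pmf p") (auto simp: set_pmf_iff)
  have int: "integrable (measure_pmf p) (likelihood t K p z)"
    using pos not_integrable_integral_eq unfolding evidence_def by fastforce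
  have "(\<integral>\<^sup>+S. ennreal (pmf p S * likelihood t K p z S / evidence t K p z) \<partial>count_space UNIV)
      = (\<integral>\<^sup>+S. ennreal (pmf p S) * ennreal (likelihood t K p z S / evidence t K p z)
           \<partial>count_space UNIV)"
    by (simp add: ennreal_mult'[symmetric])
  also have "\<dots> = (\<integral>\<^sup>+S. ennreal (likelihood t K p z S / evidence t K p z) \<partial>measure_pmf p)"
    by (simp add: nn_integral_measure_pmf)
  also have "\<dots> = ennreal (measure_pmf.expectation p (\<lambda>S. likelihood t K p z S / evidence t K p z))"
    using int nn pos by (intro nn_integral_eq_integral) (auto simp: AE_measure_pmf_iff)
  also have "\<dots> = 1"
    using pos by (simp add: evidence_def)
  finally show ?thesis
    unfolding posterior_def using nn' by (subst pmf_embed_pmf) auto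
qed

text \<open>
  The perturbation \<open>K\<close> used at timestep \<open>t\<close> with an obfuscation set of total prior probability
  \<open>\<delta>\<close>, against adversaries that know \<open>l*\<^sub>t\<close> to be in the obfuscation set.
\<close>

definition release ::
    "'z measure \<Rightarrow> nat \<Rightarrow> real \<Rightarrow> ('l, 'z) perturbation \<Rightarrow> ('l, 'z) mechanism" where
  "release \<nu> t \<delta> K =
     \<lparr>admits = (\<lambda>p z. measure_pmf.prob p {T. T t \<in> obf_set K p} = \<delta> \<and>
                      z \<in> space \<nu> \<and> evidence t K p z > 0),
      update = posterior t K\<rparr>"

text \<open>
  Mechanism \<open>Ms t\<close> is used at timestep \<open>t = 1, 2, \<dots>\<close> and outputs \<open>z t\<close>. The beliefs \<open>Pr\<^sub>t\<^sup>-\<close> and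
  \<open>Pr\<^sub>t\<^sup>+\<close> are \<open>belief_before Ms p z t\<close> and \<open>belief_after Ms p z t\<close>, where \<open>p\<close> is \<open>Pr\<^sub>1\<^sup>-\<close>. The
  recursion incorporates that \<open>Pr\<^bsub>t+1\<^esub>\<^sup>- = Pr\<^sub>t\<^sup>+\<close>.
\<close>

primrec belief_after ::
    "(nat \<Rightarrow> ('l, 'z) mechanism) \<Rightarrow> 'l belief \<Rightarrow> (nat \<Rightarrow> 'z) \<Rightarrow> nat \<Rightarrow> 'l belief" where
  "belief_after Ms p z 0 = p"
| "belief_after Ms p z (Suc t) = update (Ms (Suc t)) (belief_after Ms p z t) (z (Suc t))"

definition belief_before ::
    "(nat \<Rightarrow> ('l, 'z) mechanism) \<Rightarrow> 'l belief \<Rightarrow> (nat \<Rightarrow> 'z) \<Rightarrow> nat \<Rightarrow> 'l belief" where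
  "belief_before Ms p z t = belief_after Ms p z (t - 1)"

definition composed ::
    "nat \<Rightarrow> (nat \<Rightarrow> ('l, 'z) mechanism) \<Rightarrow> ('l, nat \<Rightarrow> 'z) mechanism" where
  "composed n Ms =
     \<lparr>admits = (\<lambda>p z. \<forall>t\<in>{1..n}. admits (Ms t) (belief_before Ms p z t) (z t)),
      update = (\<lambda>p z. belief_after Ms p z n)\<rparr>"

end

theory Submission
  imports Defs
begin

text \<open>
  The privacy bounds of the single releases form a linear recurrence for the beliefs, which is
  unrolled. A trajectory outside \<open>\<T>\<close> never gains belief, because Bayes' rule can only shrink the
  support; hence every intermediate belief is again an admissible prior for the next mechanism.
\<close>

text \<open>An error \<open>b i\<close> enters at step \<open>i\<close> and is scaled by every later
  coefficient, hence the product from \<open>i+1\<close>. Nonnegative coefficients let the bound for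
  the previous term be multiplied through in the induction.\<close>

lemma linear_recurrence_le:
  fixes a b c :: "nat \<Rightarrow> 'a::linordered_idom"
  assumes "\<And>t. t \<in> {1..n} \<Longrightarrow> 0 \<le> c t"
    and "\<And>t. t \<in> {1..n} \<Longrightarrow> a t \<le> c t * a (t - 1) + b t"
  shows "a n \<le> (\<Prod>i=1..n. c i) * a 0 + (\<Sum>i=1..n. b i * (\<Prod>j=i+1..n. c j))"
  using assms
proof (induction n)
  case 0
  then show ?case by simp
next
  case (Suc n)
  \<comment> \<open>The condition \<open>i \<le> n\<close> ensures that \<open>Suc n\<close> lies in
    the range of the product, so that its factor can be taken out.\<close>
  have split: "(\<Prod>j=i+1..Suc n. c j) = c (Suc n) * (\<Prod>j=i+1..n. c j)" if "i \<le> n" for i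
    using that by (simp add: mult.commute)
  have "a (Suc n) \<le> c (Suc n) * a n + b (Suc n)"
    using Suc.prems(2)[of "Suc n"] by simp
  also have "\<dots> \<le> c (Suc n) * ((\<Prod>i=1..n. c i) * a 0 + (\<Sum>i=1..n. b i * (\<Prod>j=i+1..n. c j)))
      + b (Suc n)"
    using Suc.prems Suc.IH by (intro add_right_mono mult_left_mono) auto
  also have "\<dots> = (\<Prod>i=1..Suc n. c i) * a 0
      + ((\<Sum>i=1..n. b i * (\<Prod>j=i+1..Suc n. c j)) + b (Suc n))"
    by (simp add: split sum_distrib_left algebra_simps)
  \<comment> \<open>The isolated \<open>b (Suc n)\<close> is the summand for
    \<open>i = Suc n\<close>, whose product is empty.\<close>
  also have "\<dots> = (\<Prod>i=1..Suc n. c i) * a 0 + (\<Sum>i=1..Suc n. b i * (\<Prod>j=i+1..Suc n. c j))"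
    by simp
  finally show ?case .
qed

text \<open>Bayes' rule multiplies each prior mass by a factor, so a mass of zero stays zero. The
  assumptions are those under which \<open>embed_pmf\<close> has the intended mass function.\<close>

lemma set_pmf_posterior_subset:
  assumes "is_perturbation \<nu> L K" and "\<And>T. T \<in> set_pmf p \<Longrightarrow> T t \<in> L"
    and "z \<in> space \<nu>" and "evidence t K p z > 0"
  shows "set_pmf (posterior t K p z) \<subseteq> set_pmf p"
proof -
  have "pmf (posterior t K p z) T = pmf p T * likelihood t K p z T / evidence t K p z" for T
    using assms by (rule pmf_posterior)
  then show ?thesis
    by (auto simp: set_pmf_iff)
qed

text \<open>The form of the update is left abstract: \<open>supp\<close> is all that remains of
  Bayes' rule. The recurrence is applied to the belief in one fixed trajectory, with coefficients
  \<open>inverse (\<delta> t) * exp (\<epsilon> t)\<close>.\<close>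

lemma trajectory_private_composed:
  assumes "n \<ge> 1"
    and nonneg: "\<And>t. t \<in> {1..n} \<Longrightarrow> 0 \<le> \<delta> t"
    and priv: "\<And>t. t \<in> {1..n} \<Longrightarrow> trajectory_private \<T> (M t) (\<epsilon> t) (\<delta> t) (\<theta> t)"
    and supp: "\<And>t p z. t \<in> {1..n} \<Longrightarrow> set_pmf p \<subseteq> \<T> \<Longrightarrow> admits (M t) p z \<Longrightarrow>
      set_pmf (update (M t) p z) \<subseteq> \<T>"
  shows "trajectory_private \<T> (composed n M)
           (\<Sum>i=1..n. \<epsilon> i)
           (\<Prod>i=1..n. \<delta> i)
           (\<theta> n + (\<Sum>i=1..n - 1. \<theta> i * (\<Prod>j=i+1..n. inverse (\<delta> j) * exp (\<epsilon> j))))"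
  unfolding trajectory_private_def
proof (intro allI impI ballI)
  fix p z T
  assume p: "set_pmf p \<subseteq> \<T>" and adm: "admits (composed n M) p z" and T: "T \<in> \<T>"
  let ?B = "belief_after M p z" and ?c = "\<lambda>t. inverse (\<delta> t) * exp (\<epsilon> t)"
  \<comment> \<open>Since \<open>?B 0\<close> is the initial prior \<open>p\<close>, the index
    \<open>t - 1\<close> is the right one for the belief before release \<open>t\<close>, also at
    \<open>t = 1\<close>.\<close>
  have step: "?B t = update (M t) (?B (t - 1)) (z t)" "admits (M t) (?B (t - 1)) (z t)"
    if "t \<in> {1..n}" for t
  proof -
    show "?B t = update (M t) (?B (t - 1)) (z t)"
      using that by (cases t) simp_all
    show "admits (M t) (?B (t - 1)) (z t)"
      using that adm by (simp add: composed_def belief_before_def)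
  qed
  have B_supp: "set_pmf (?B t) \<subseteq> \<T>" if "t \<le> n" for t
    using that
  proof (induction t)
    case (Suc t)
    then show ?case
      using supp[of "Suc t" "?B t"] step(2)[of "Suc t"] by simp
  qed (use p in simp)
  have "pmf (?B t) T \<le> ?c t * pmf (?B (t - 1)) T + \<theta> t" if "t \<in> {1..n}" for t
    using priv[OF that] step[OF that] B_supp[of "t - 1"] T that
    by (auto simp: trajectory_private_def)
  then have "pmf (?B n) T \<le> (\<Prod>i=1..n. ?c i) * pmf (?B 0) T
      + (\<Sum>i=1..n. \<theta> i * (\<Prod>j=i+1..n. ?c j))"
    using nonneg by (intro linear_recurrence_le[where a = "\<lambda>t. pmf (?B t) T"]) auto
  also have "(\<Prod>i=1..n. ?c i) = inverse (\<Prod>i=1..n. \<delta> i) * exp (\<Sum>i=1..n. \<epsilon> i)"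
    using prod_inversef[of \<delta> "{1..n}"] by (simp add: prod.distrib exp_sum comp_def)
  \<comment> \<open>The last summand has an empty product and leaves \<open>\<theta> n\<close>. This
    uses \<open>n \<ge> 1\<close>: for \<open>n = 0\<close> the left side would be \<open>0\<close>
    and the right side \<open>\<theta> 0\<close>.\<close>
  also have "(\<Sum>i=1..n. \<theta> i * (\<Prod>j=i+1..n. ?c j))
      = \<theta> n + (\<Sum>i=1..n - 1. \<theta> i * (\<Prod>j=i+1..n. ?c j))"
    using \<open>n \<ge> 1\<close> by (cases n) (simp_all add: add.commute)
  finally show "pmf (update (composed n M) p z) T
      \<le> inverse (\<Prod>i=1..n. \<delta> i) * exp (\<Sum>i=1..n. \<epsilon> i) * pmf p T
        + (\<theta> n + (\<Sum>i=1..n - 1. \<theta> i * (\<Prod>j=i+1..n. ?c j)))"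
    by (simp add: composed_def)
qed

theorem theorem5p7:
  fixes \<T> :: "'l trajectory set" and L :: "nat \<Rightarrow> 'l set" and \<nu> :: "nat \<Rightarrow> 'z measure"
    and K :: "nat \<Rightarrow> ('l, 'z) perturbation" and M :: "nat \<Rightarrow> ('l, 'z) mechanism"
    and \<epsilon> \<delta> \<theta> :: "nat \<Rightarrow> real" and n :: nat
  assumes "n \<ge> 1"
    and "\<And>T t. T \<in> \<T> \<Longrightarrow> t \<in> {1..n} \<Longrightarrow> T t \<in> L t"
    and "\<And>t. t \<in> {1..n} \<Longrightarrow> 0 < \<delta> t \<and> \<delta> t \<le> 1"
    and "\<And>t. t \<in> {1..n} \<Longrightarrow> is_perturbation (\<nu> t) (L t) (K t)"
    and "\<And>t. t \<in> {1..n} \<Longrightarrow> M t = release (\<nu> t) t (\<delta> t) (K t)"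
    and "\<And>t. t \<in> {1..n} \<Longrightarrow> trajectory_private \<T> (M t) (\<epsilon> t) (\<delta> t) (\<theta> t)"
  shows "trajectory_private \<T> (composed n M)
           (\<Sum>i=1..n. \<epsilon> i)
           (\<Prod>i=1..n. \<delta> i)
           (\<theta> n + (\<Sum>i=1..n - 1. \<theta> i * (\<Prod>j=i+1..n. inverse (\<delta> j) * exp (\<epsilon> j))))"
proof (rule trajectory_private_composed)
  fix t p z
  assume t: "t \<in> {1..n}" and p: "set_pmf p \<subseteq> \<T>" and adm: "admits (M t) p z"
  \<comment> \<open>Admissibility supplies an output in the space of \<open>\<nu> t\<close> with
    positive evidence; support in \<open>\<T>\<close> places the location at \<open>t\<close> in
    \<open>L t\<close>.\<close>
  have "set_pmf (posterior t (K t) p z) \<subseteq> set_pmf p"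
    using adm p t assms(2) unfolding assms(5)[OF t]
    by (intro set_pmf_posterior_subset[OF assms(4)[OF t]]) (auto simp: release_def)
  then show "set_pmf (update (M t) p z) \<subseteq> \<T>"
    using p by (simp add: assms(5)[OF t] release_def)
qed (use assms in \<open>auto simp: less_imp_le\<close>)

end
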